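(* Let $(X,d_X)$ and $(Y,d_Y)$ be finite metric spaces and let $G'$ and $H'$ be the corresponding minimum complete graphs (the complete weighted graphs on vertex sets $X$ and $Y$ in which the edge between two distinct points has weight equal to their distance). The following are equivalent: \begin{enumerate} \item $(X,d_X)$ and $(Y,d_Y)$ are isometric. \item The metric isometry game $Isom(X,Y)$ played on $(X,d_X)$ and $(Y,d_Y)$ has a winning classical strategy. \item The minimum complete graphs $G'$ and $H'$ are isomorphic (as weighted graphs). \item The weighted graph isomorphism game for $G'$ and $H'$ has a winning classical strategy. \end{enumerate}
   Context: Two finite metric spaces are isometric if there is a bijection $f:X\to Y$ with $d_X(x,x')=d_Y(f(x),f(x'))$ for all $x,x'\in X$. A two-player non-local game has finite input sets and output sets for Alice and Bob and a rule function $\lambda$; a round with inputs $(v,w)$ (to Alice and Bob) and outputs $(a,b)$ (from Alice and Bob) is won iff $\lambda(v,w,a,b)=1$. A deterministic strategy is a pair of functions $h,k$ from inputs to outputs (for Alice and Bob), and it is winning (perfect) if $\lambda(v,w,h(v),k(w))=1$ for all $(v,w)$. A winning classical strategy is a perfect deterministic strategy or, equivalently, a perfect strategy in which the players use only a shared probability space (a perfect local strategy: losing rounds occur with probability $0$). Metric isometry game $Isom(X,Y)$: for both players the input set and the output set are $X\sqcup Y$. With inputs $v,w$ and outputs $a,b$ for Alice and Bob, respectively, the players win iff: (i) $v$ and $a$ are from different spaces; (ii) $w$ and $b$ are from different spaces; (iii) if $v$ and $w$ are from the same metric space, then $d_\bullet(v,w)=d_\bullet(a,b)$, where $d_\bullet$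 is the metric of the space to which the points belong; (iv) if $v$ and $w$ are from different spaces, then $v=b$ if and only if $w=a$. Weighted graph isomorphism game for $G'$ and $H'$: inputs and outputs for both players are $V(G')\sqcup V(H')$. With inputs $v,w$ and outputs $a,b$, the players win iff: (i) $v$ and $a$ are from different graphs; (ii) $w$ and $b$ are from different graphs; (iii) if $v$ and $w$ are from the same graph, then $d_\bullet(v,w)=d_\bullet(a,b)$, where $d_\bullet$ denotes minimum path length (minimum total weight of a path) in the relevant minimum complete graph; (iv) if $v$ and $w$ are from different graphs, then $v=b$ if and only if $w=a$. An isomorphism of weighted complete graphs is a bijection of vertex sets preserving edge weights. *)

theory Defs
  imports "HOL-Probability.Probability" "Graph_Theory.Shortest_Path" "Graph_Theory.Pair_Digraph"
begin

section \<open>Finite metric spaces\<close>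

definition isometric :: "'a set \<Rightarrow> ('a \<Rightarrow> 'a \<Rightarrow> real) \<Rightarrow> 'b set \<Rightarrow> ('b \<Rightarrow> 'b \<Rightarrow> real) \<Rightarrow> bool" where
  "isometric X dX Y dY \<longleftrightarrow>
     (\<exists>f. bij_betw f X Y \<and> (\<forall>x\<in>X. \<forall>x'\<in>X. dX x x' = dY (f x) (f x')))"

section \<open>Two-player non-local games\<close>

record ('v, 'w, 'a, 'b) nonlocal_game =
  alice_in :: "'v set"
  bob_in :: "'w set"
  alice_out :: "'a set"
  bob_out :: "'b set"
  rule :: "'v \<Rightarrow> 'w \<Rightarrow> 'a \<Rightarrow> 'b \<Rightarrow> bool"

definition finite_game :: "('v, 'w, 'a, 'b) nonlocal_game \<Rightarrow> bool" where
  "finite_game \<G> \<longleftrightarrow>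
     finite (alice_in \<G>) \<and> finite (bob_in \<G>) \<and> finite (alice_out \<G>) \<and> finite (bob_out \<G>)"

definition perfect_deterministic ::
    "('v, 'w, 'a, 'b) nonlocal_game \<Rightarrow> ('v \<Rightarrow> 'a) \<Rightarrow> ('w \<Rightarrow> 'b) \<Rightarrow> bool" where
  "perfect_deterministic \<G> h k \<longleftrightarrow>
     h \<in> alice_in \<G> \<rightarrow> alice_out \<G> \<and> k \<in> bob_in \<G> \<rightarrow> bob_out \<G> \<and>
     (\<forall>v\<in>alice_in \<G>. \<forall>w\<in>bob_in \<G>. rule \<G> v w (h v) (k w))"

definition has_winning_classical_strategy :: "('v, 'w, 'a, 'b) nonlocal_game \<Rightarrow> bool" where
  "has_winning_classical_strategy \<G> \<longleftrightarrow> (\<exists>h k. perfect_deterministic \<G> h k)"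

text \<open>
  Classical strategies may also be allowed to use a shared probability space \<open>M\<close>: on input \<open>v\<close>,
  Alice answers with the value of a random variable \<open>A v\<close>, and Bob likewise with \<open>B w\<close>. By the
  lemma below, this does not affect the existence of a perfect strategy. It holds for every choice
  of the type \<open>'s\<close> of sample points.
\<close>

definition perfect_local ::
    "('v, 'w, 'a, 'b) nonlocal_game \<Rightarrow> 's measure \<Rightarrow> ('v \<Rightarrow> 's \<Rightarrow> 'a) \<Rightarrow> ('w \<Rightarrow> 's \<Rightarrow> 'b) \<Rightarrow> bool" where
  "perfect_local \<G> M A B \<longleftrightarrow>
     prob_space M \<and>
     (\<forall>v\<in>alice_in \<G>. A v \<in> M \<rightarrow>\<^sub>M count_space (alice_out \<G>)) \<and>
     (\<forall>w\<in>bob_in \<G>. B w \<in> M \<rightarrow>\<^sub>M count_space (bob_out \<G>)) \<and>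
     (\<forall>v\<in>alice_in \<G>. \<forall>w\<in>bob_in \<G>.
        measure M {s \<in> space M. \<not> rule \<G> v w (A v s) (B w s)} = 0)"

lemma has_winning_classical_strategy_iff_perfect_local:
  assumes "finite_game \<G>"
  shows "has_winning_classical_strategy \<G> \<longleftrightarrow>
         (\<exists>(M :: 's measure) A B. perfect_local \<G> M A B)"
proof
  assume "has_winning_classical_strategy \<G>"
  then obtain h k where "perfect_deterministic \<G> h k"
    by (auto simp: has_winning_classical_strategy_def)
  moreover have "prob_space (return (count_space UNIV) (undefined :: 's))"
    by (rule prob_space_return) simp
  ultimately have "perfect_local \<G> (return (count_space UNIV) (undefined :: 's)) (\<lambda>v _. h v) (\<lambda>w _. k w)"
    by (auto simp: perfect_deterministic_def perfect_local_def Pi_iff)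
  then show "\<exists>(M :: 's measure) A B. perfect_local \<G> M A B" by blast
next
  assume "\<exists>(M :: 's measure) A B. perfect_local \<G> M A B"
  then obtain M :: "'s measure" and A B where L: "perfect_local \<G> M A B" by blast
  interpret prob_space M using L by (simp add: perfect_local_def)
  have fin: "finite (alice_in \<G>)" "finite (bob_in \<G>)" "finite (alice_out \<G>)" "finite (bob_out \<G>)"
    using assms by (auto simp: finite_game_def)
  have witness: "\<exists>s\<in>space M. P s" if P: "AE s in M. P s" for P
  proof (rule ccontr)
    assume "\<not> (\<exists>s\<in>space M. P s)"
    then have none: "\<And>s. s \<in> space M \<Longrightarrow> \<not> P s"
      by blast
    have "AE s in M. False"
      using P by (rule AE_mp) (auto intro: AE_I2 simp: none)
    then show False by simp
  qed
  have "AE s in M. rule \<G> v w (A v s) (B w s)"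
    if vw: "v \<in> alice_in \<G>" "w \<in> bob_in \<G>" for v w
  proof -
    have A: "A v \<in> M \<rightarrow>\<^sub>M count_space (alice_out \<G>)" and B: "B w \<in> M \<rightarrow>\<^sub>M count_space (bob_out \<G>)"
      and 0: "measure M {s \<in> space M. \<not> rule \<G> v w (A v s) (B w s)} = 0"
      using L vw by (auto simp: perfect_local_def)
    have eq: "{s \<in> space M. \<not> rule \<G> v w (A v s) (B w s)} =
      (\<Union>(a, b) \<in> {(a, b) \<in> alice_out \<G> \<times> bob_out \<G>. \<not> rule \<G> v w a b}.
         (A v -` {a} \<inter> space M) \<inter> (B w -` {b} \<inter> space M))"
      using measurable_space[OF A] measurable_space[OF B] by auto
    have "{s \<in> space M. \<not> rule \<G> v w (A v s) (B w s)} \<in> sets M"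
      unfolding eq
    proof (rule sets.finite_UN)
      show "finite {(a, b) \<in> alice_out \<G> \<times> bob_out \<G>. \<not> rule \<G> v w a b}"
        by (rule finite_subset[of _ "alice_out \<G> \<times> bob_out \<G>"]) (use fin in auto)
    next
      fix p assume "p \<in> {(a, b) \<in> alice_out \<G> \<times> bob_out \<G>. \<not> rule \<G> v w a b}"
      then show "(case p of (a, b) \<Rightarrow> (A v -` {a} \<inter> space M) \<inter> (B w -` {b} \<inter> space M)) \<in> sets M"
        by (auto intro!: sets.Int measurable_sets[OF A] measurable_sets[OF B])
    qed
    then show ?thesis
      using 0 by (intro AE_I[where N = "{s \<in> space M. \<not> rule \<G> v w (A v s) (B w s)}"])
        (auto simp: emeasure_eq_measure)
  qed
  then have "AE s in M. \<forall>v\<in>alice_in \<G>. \<forall>w\<in>bob_in \<G>. rule \<G> v w (A v s) (B w s)"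
    using fin by (simp add: AE_finite_all)
  then have "\<exists>s\<in>space M. \<forall>v\<in>alice_in \<G>. \<forall>w\<in>bob_in \<G>. rule \<G> v w (A v s) (B w s)"
    by (rule witness)
  then obtain s where s: "s \<in> space M"
    "\<forall>v\<in>alice_in \<G>. \<forall>w\<in>bob_in \<G>. rule \<G> v w (A v s) (B w s)" by blast
  have "perfect_deterministic \<G> (\<lambda>v. A v s) (\<lambda>w. B w s)"
    unfolding perfect_deterministic_def
  proof (intro conjI funcsetI)
    show "A v s \<in> alice_out \<G>" if "v \<in> alice_in \<G>" for v
      using L that measurable_space[of "A v" M _ s] s(1) by (fastforce simp: perfect_local_def)
    show "B w s \<in> bob_out \<G>" if "w \<in> bob_in \<G>" for w
      using L that measurable_space[of "B w" M _ s] s(1) by (fastforce simp: perfect_local_def)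
  qed (use s(2) in blast)
  then show "has_winning_classical_strategy \<G>"
    by (auto simp: has_winning_classical_strategy_def)
qed

section \<open>The isometry and isomorphism games\<close>

text \<open>
  Both games are played on a disjoint union and differ only in the distance functions. The third
  equation of \<open>dist_in_same\<close> is never relevant: the function is only used for two points coming
  from the same side.
\<close>

fun dist_in_same :: "('a \<Rightarrow> 'a \<Rightarrow> 'r) \<Rightarrow> ('b \<Rightarrow> 'b \<Rightarrow> 'r) \<Rightarrow> 'a + 'b \<Rightarrow> 'a + 'b \<Rightarrow> 'r" where
  "dist_in_same d1 d2 (Inl x) (Inl x') = d1 x x'"
| "dist_in_same d1 d2 (Inr y) (Inr y') = d2 y y'"
| "dist_in_same d1 d2 _ _ = undefined"

definition matching_rule ::
    "('a \<Rightarrow> 'a \<Rightarrow> 'r) \<Rightarrow> ('b \<Rightarrow> 'b \<Rightarrow> 'r) \<Rightarrow> 'a + 'b \<Rightarrow> 'a + 'b \<Rightarrow> 'a + 'b \<Rightarrow> 'a + 'b \<Rightarrow> bool" where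
  "matching_rule d1 d2 v w a b \<longleftrightarrow>
     isl v \<noteq> isl a \<and>
     isl w \<noteq> isl b \<and>
     (isl v = isl w \<longrightarrow> dist_in_same d1 d2 v w = dist_in_same d1 d2 a b) \<and>
     (isl v \<noteq> isl w \<longrightarrow> (v = b \<longleftrightarrow> w = a))"

definition metric_isometry_game ::
    "'a set \<Rightarrow> ('a \<Rightarrow> 'a \<Rightarrow> real) \<Rightarrow> 'b set \<Rightarrow> ('b \<Rightarrow> 'b \<Rightarrow> real) \<Rightarrow>
     ('a + 'b, 'a + 'b, 'a + 'b, 'a + 'b) nonlocal_game" where
  "metric_isometry_game X dX Y dY =
     \<lparr> alice_in = X <+> Y, bob_in = X <+> Y, alice_out = X <+> Y, bob_out = X <+> Y,
       rule = matching_rule dX dY \<rparr>"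

lemma finite_game_metric_isometry_game:
  "finite X \<Longrightarrow> finite Y \<Longrightarrow> finite_game (metric_isometry_game X dX Y dY)"
  by (simp add: finite_game_def metric_isometry_game_def)

text \<open>
  An undirected weighted graph is represented by a symmetric digraph and a weight function on its
  arcs. The constant \<open>wf_digraph.\<mu>\<close> is the infimum, in the extended reals, of the total weights of
  all walks between two vertices; for the nonnegative weights considered here it is attained by a
  path.
\<close>

definition weighted_graph_isomorphism_game ::
    "'a pair_pre_digraph \<Rightarrow> ('a \<times> 'a) weight_fun \<Rightarrow> 'b pair_pre_digraph \<Rightarrow> ('b \<times> 'b) weight_fun \<Rightarrow>
     ('a + 'b, 'a + 'b, 'a + 'b, 'a + 'b) nonlocal_game" where
  "weighted_graph_isomorphism_game G wG H wH =
     \<lparr> alice_in = pverts G <+> pverts H, bob_in = pverts G <+> pverts H,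
       alice_out = pverts G <+> pverts H, bob_out = pverts G <+> pverts H,
       rule = matching_rule (wf_digraph.\<mu> (with_proj G) wG) (wf_digraph.\<mu> (with_proj H) wH) \<rparr>"

lemma finite_game_weighted_graph_isomorphism_game:
  "finite (pverts G) \<Longrightarrow> finite (pverts H) \<Longrightarrow>
     finite_game (weighted_graph_isomorphism_game G wG H wH)"
  by (simp add: finite_game_def weighted_graph_isomorphism_game_def)

section \<open>Minimum complete graphs\<close>

definition min_complete_graph :: "'a set \<Rightarrow> 'a pair_pre_digraph" where
  "min_complete_graph X = \<lparr> pverts = X, parcs = {(x, x'). x \<in> X \<and> x' \<in> X \<and> x \<noteq> x'} \<rparr>"

definition min_complete_weight :: "('a \<Rightarrow> 'a \<Rightarrow> real) \<Rightarrow> ('a \<times> 'a) weight_fun" where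
  "min_complete_weight d = (\<lambda>(x, x'). d x x')"

lemma wf_digraph_min_complete_graph: "wf_digraph (with_proj (min_complete_graph X))"
  by unfold_locales (auto simp: min_complete_graph_def)

text \<open>For complete graphs, a bijection of the vertices automatically preserves adjacency.\<close>

definition complete_weighted_graphs_isomorphic ::
    "'a pair_pre_digraph \<Rightarrow> ('a \<times> 'a) weight_fun \<Rightarrow> 'b pair_pre_digraph \<Rightarrow> ('b \<times> 'b) weight_fun \<Rightarrow> bool" where
  "complete_weighted_graphs_isomorphic G wG H wH \<longleftrightarrow>
     (\<exists>f. bij_betw f (pverts G) (pverts H) \<and>
          (\<forall>(u, v) \<in> parcs G. wG (u, v) = wH (f u, f v)))"

end

theory Submission
  imports Defs
begin

text \<open>
  Both games are the same matching game, played with two pairs of distance functions, and in such a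
  game the winning deterministic strategies are the isometries in disguise. Indeed, let Alice answer
  by \<open>h\<close> and Bob by \<open>k\<close>. Each of them sends points of \<open>X\<close> to points of \<open>Y\<close> and vice versa. The
  rule for two inputs from the same space, applied to one point \<open>x\<close> given to both players,
  says that the two answers are at distance \<open>d x x = 0\<close>; hence \<open>h x = k x\<close>, so the two players use the
  same map \<open>f\<close> on \<open>X\<close>, and the same rule then says that \<open>f\<close> preserves distances. The rule for inputs
  from different spaces says that Alice's map from \<open>X\<close> to \<open>Y\<close> and Bob's map from \<open>Y\<close> to \<open>X\<close> are
  inverse to each other, so \<open>f\<close> is a bijection. Conversely, if \<open>f\<close> is an isometry, both players
  answer by \<open>f\<close> on \<open>X\<close> and by its inverse on \<open>Y\<close>. This is
  \<open>winning_matching_strategy_iff_isometry\<close>.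

  It remains to compare the distances. By the triangle inequality, a walk in the minimum complete
  graph is at least as long as the distance of its ends, and for distinct ends the arc between them
  attains this bound, so the minimum path length in that graph is the metric itself
  (\<open>min_path_length_min_complete_graph\<close>). Therefore the isomorphism game of the
  graphs is won by the same strategies as the isometry game of the spaces. An isomorphism
  of the graphs differs from an isometry only in that nothing is asked about the distance of a
  point from itself, and this distance is always zero.
\<close>

text \<open>
  The properties of a metric behind the argument are two: the points have the same self-distance \<open>z\<close> on
  both sides, and \<open>z\<close> does not occur as the distance of two distinct points of \<open>Y\<close>. The values are
  of an arbitrary type because the isometry game uses real distances, and the isomorphism game
  extended real ones.
\<close>

lemma winning_matching_strategy_iff_isometry:
  fixes d1 :: "'a \<Rightarrow> 'a \<Rightarrow> 'r" and d2 :: "'b \<Rightarrow> 'b \<Rightarrow> 'r"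
  assumes refl1: "\<And>x. x \<in> X \<Longrightarrow> d1 x x = z"
    and zero2: "\<And>y y'. y \<in> Y \<Longrightarrow> y' \<in> Y \<Longrightarrow> d2 y y' = z \<longleftrightarrow> y = y'"
  shows "has_winning_classical_strategy
           \<lparr> alice_in = X <+> Y, bob_in = X <+> Y, alice_out = X <+> Y, bob_out = X <+> Y,
             rule = matching_rule d1 d2 \<rparr> \<longleftrightarrow>
         (\<exists>f. bij_betw f X Y \<and> (\<forall>x\<in>X. \<forall>x'\<in>X. d1 x x' = d2 (f x) (f x')))"
    (is "has_winning_classical_strategy ?G \<longleftrightarrow> ?isometric")
proof
  assume "has_winning_classical_strategy ?G"
  then obtain h k where "perfect_deterministic ?G h k"
    by (auto simp: has_winning_classical_strategy_def)
  then have h: "\<And>v. v \<in> X <+> Y \<Longrightarrow> h v \<in> X <+> Y"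
    and k: "\<And>v. v \<in> X <+> Y \<Longrightarrow> k v \<in> X <+> Y"
    and win: "\<And>v w. v \<in> X <+> Y \<Longrightarrow> w \<in> X <+> Y \<Longrightarrow> matching_rule d1 d2 v w (h v) (k w)"
    by (auto simp: perfect_deterministic_def)
  have "\<exists>y\<in>Y. h (Inl x) = Inr y" if "x \<in> X" for x
    using h[OF InlI[OF that]] win[OF InlI InlI, OF that that] by (auto simp: matching_rule_def)
  then obtain f where f: "\<And>x. x \<in> X \<Longrightarrow> f x \<in> Y" "\<And>x. x \<in> X \<Longrightarrow> h (Inl x) = Inr (f x)"
    by metis
  have "\<exists>x\<in>X. k (Inr y) = Inl x" if "y \<in> Y" for y
    using k[OF InrI[OF that]] win[OF InrI InrI, OF that that] by (auto simp: matching_rule_def)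
  then obtain g where g: "\<And>y. y \<in> Y \<Longrightarrow> g y \<in> X" "\<And>y. y \<in> Y \<Longrightarrow> k (Inr y) = Inl (g y)"
    by metis
  have k_eq: "k (Inl x) = Inr (f x)" if x: "x \<in> X" for x
  proof -
    obtain y where y: "y \<in> Y" "k (Inl x) = Inr y"
      using k[OF InlI[OF x]] win[OF InlI InlI, OF x x] by (auto simp: matching_rule_def)
    then have "d2 (f x) y = z"
      using win[OF InlI InlI, OF x x] x by (simp add: matching_rule_def f(2) refl1)
    then show ?thesis
      using zero2 f(1) x y by auto
  qed
  have inverse: "x = g y \<longleftrightarrow> y = f x" if "x \<in> X" "y \<in> Y" for x y
    using win[OF InlI InrI, OF that] that by (simp add: matching_rule_def f(2) g(2))
  have "bij_betw f X Y"
  proof (rule bij_betwI[where g = g])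
    show "g (f x) = x" if "x \<in> X" for x
      using inverse[of x "f x"] f(1) that by simp
    show "f (g y) = y" if "y \<in> Y" for y
      using inverse[of "g y" y] g(1) that by simp
  qed (use f(1) g(1) in auto)
  moreover have "d1 x x' = d2 (f x) (f x')" if "x \<in> X" "x' \<in> X" for x x'
    using win[OF InlI InlI, OF that] that by (simp add: matching_rule_def f(2) k_eq)
  ultimately show ?isometric by blast
next
  assume ?isometric
  then obtain f where f: "bij_betw f X Y" "\<And>x x'. x \<in> X \<Longrightarrow> x' \<in> X \<Longrightarrow> d1 x x' = d2 (f x) (f x')"
    by blast
  define g where "g = inv_into X f"
  have fY: "f x \<in> Y" and gf: "g (f x) = x" if "x \<in> X" for x
    using f(1) that by (auto simp: g_def bij_betw_inv_into_left bij_betwE)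
  have gX: "g y \<in> X" and fg: "f (g y) = y" if "y \<in> Y" for y
    using f(1) that bij_betwE[OF bij_betw_inv_into[OF f(1)]]
    by (auto simp: g_def bij_betw_inv_into_right)
  define s where "s v = (case v of Inl x \<Rightarrow> Inr (f x) | Inr y \<Rightarrow> Inl (g y))" for v
  have "perfect_deterministic ?G s s"
    by (auto simp: perfect_deterministic_def matching_rule_def s_def f(2) fY gX gf fg)
  then show "has_winning_classical_strategy ?G"
    by (auto simp: has_winning_classical_strategy_def)
qed

lemma min_complete_graph_simps:
  "pverts (min_complete_graph X) = X"
  "(u, v) \<in> parcs (min_complete_graph X) \<longleftrightarrow> u \<in> X \<and> v \<in> X \<and> u \<noteq> v"
  by (auto simp: min_complete_graph_def)

text \<open>
  The triangle inequality, applied once for each arc of the walk.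
\<close>

lemma metric_le_awalk_cost:
  assumes "Metric_space X d"
    and "pre_digraph.awalk (with_proj (min_complete_graph X)) u p v"
  shows "d u v \<le> wf_digraph.awalk_cost (min_complete_weight d) p"
proof -
  interpret Metric_space X d by fact
  interpret G: wf_digraph "with_proj (min_complete_graph X)"
    by (rule wf_digraph_min_complete_graph)
  show ?thesis
    using assms(2)
  proof (induction p arbitrary: u)
    case Nil
    then show ?case by (auto simp: G.awalk_Nil_iff min_complete_graph_simps)
  next
    case (Cons e p)
    obtain w where e: "e = (u, w)"
      using Cons.prems by (cases e) (simp add: G.awalk_Cons_iff)
    then have walk: "G.awalk w p v" and "u \<in> X" "w \<in> X"
      using Cons.prems by (auto simp: G.awalk_Cons_iff min_complete_graph_simps)
    moreover have "v \<in> X"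
      using G.awalk_last_in_verts[OF walk] by (simp add: min_complete_graph_simps)
    ultimately have "d u v \<le> d u w + d w v"
      by (simp add: triangle)
    also have "d w v \<le> G.awalk_cost (min_complete_weight d) p"
      using Cons.IH walk .
    finally show ?case
      by (simp add: e min_complete_weight_def)
  qed
qed

lemma min_path_length_min_complete_graph:
  assumes "Metric_space X d" and "u \<in> X" and "v \<in> X"
  shows "wf_digraph.\<mu> (with_proj (min_complete_graph X)) (min_complete_weight d) u v = ereal (d u v)"
proof -
  interpret Metric_space X d by fact
  interpret G: wf_digraph "with_proj (min_complete_graph X)"
    by (rule wf_digraph_min_complete_graph)
  \<comment> \<open>There are no loops, so a point is joined to itself only by the empty walk of cost zero.\<close>
  define p where "p = (if u = v then [] else [(u, v)])"
  have "G.awalk u p v" and "G.awalk_cost (min_complete_weight d) p = d u v"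
    using assms(2,3)
    by (auto simp: p_def G.awalk_Nil_iff G.awalk_Cons_iff min_complete_graph_simps
        min_complete_weight_def)
  then have "G.\<mu> (min_complete_weight d) u v \<le> ereal (d u v)"
    using G.min_cost_le_walk_cost by metis
  moreover have "ereal (d u v) \<le> G.\<mu> (min_complete_weight d) u v"
    unfolding G.\<mu>_def using metric_le_awalk_cost[OF assms(1)] by (auto intro!: INF_greatest)
  ultimately show ?thesis by (rule antisym)
qed

lemma isometric_iff_complete_weighted_graphs_isomorphic:
  assumes "Metric_space X dX" and "Metric_space Y dY"
  shows "isometric X dX Y dY \<longleftrightarrow>
         complete_weighted_graphs_isomorphic
           (min_complete_graph X) (min_complete_weight dX)
           (min_complete_graph Y) (min_complete_weight dY)"
proof -
  interpret X: Metric_space X dX by fact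
  interpret Y: Metric_space Y dY by fact
  have "(\<forall>x\<in>X. \<forall>x'\<in>X. dX x x' = dY (f x) (f x')) \<longleftrightarrow>
        (\<forall>x\<in>X. \<forall>x'\<in>X. x \<noteq> x' \<longrightarrow> dX x x' = dY (f x) (f x'))"
    if "bij_betw f X Y" for f
  proof -
    \<comment> \<open>The pairs that are not arcs are those on the diagonal, where both distances vanish.\<close>
    have "dX x x = dY (f x) (f x)" if "x \<in> X" for x
      using that bij_betwE[OF \<open>bij_betw f X Y\<close>] by simp
    then show ?thesis by metis
  qed
  then show ?thesis
    unfolding isometric_def complete_weighted_graphs_isomorphic_def
    by (auto simp: min_complete_graph_def min_complete_weight_def)
qed

theorem theorem3p2:
  fixes X :: "'a set" and dX :: "'a \<Rightarrow> 'a \<Rightarrow> real"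
    and Y :: "'b set" and dY :: "'b \<Rightarrow> 'b \<Rightarrow> real"
  assumes "Metric_space X dX" and "finite X"
    and "Metric_space Y dY" and "finite Y"
  shows "(isometric X dX Y dY \<longleftrightarrow>
            has_winning_classical_strategy (metric_isometry_game X dX Y dY)) \<and>
         (isometric X dX Y dY \<longleftrightarrow>
            complete_weighted_graphs_isomorphic
              (min_complete_graph X) (min_complete_weight dX)
              (min_complete_graph Y) (min_complete_weight dY)) \<and>
         (isometric X dX Y dY \<longleftrightarrow>
            has_winning_classical_strategy
              (weighted_graph_isomorphism_game
                (min_complete_graph X) (min_complete_weight dX)
                (min_complete_graph Y) (min_complete_weight dY)))"
proof -
  interpret X: Metric_space X dX by fact
  interpret Y: Metric_space Y dY by fact
  let ?mX = "wf_digraph.\<mu> (with_proj (min_complete_graph X)) (min_complete_weight dX)"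
  let ?mY = "wf_digraph.\<mu> (with_proj (min_complete_graph Y)) (min_complete_weight dY)"
  note mX = min_path_length_min_complete_graph[OF assms(1)]
    and mY = min_path_length_min_complete_graph[OF assms(3)]
  have "has_winning_classical_strategy (metric_isometry_game X dX Y dY) \<longleftrightarrow> isometric X dX Y dY"
    unfolding metric_isometry_game_def isometric_def
    by (rule winning_matching_strategy_iff_isometry[where z = 0]) simp_all
  moreover have "has_winning_classical_strategy
      (weighted_graph_isomorphism_game
        (min_complete_graph X) (min_complete_weight dX)
        (min_complete_graph Y) (min_complete_weight dY)) \<longleftrightarrow>
      (\<exists>f. bij_betw f X Y \<and> (\<forall>x\<in>X. \<forall>x'\<in>X. ?mX x x' = ?mY (f x) (f x')))"
    unfolding weighted_graph_isomorphism_game_def min_complete_graph_simps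
    by (rule winning_matching_strategy_iff_isometry[where z = 0]) (simp_all add: mX mY)
  moreover have "\<dots> \<longleftrightarrow> isometric X dX Y dY"
    unfolding isometric_def by (simp add: mX mY bij_betw_apply cong: conj_cong)
  ultimately show ?thesis
    using isometric_iff_complete_weighted_graphs_isomorphic[OF assms(1,3)] by simp
qed

end
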